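(* Let $\mathbf{RCi}$ be the logic obtained from $\mathbf{RmbC}$ by adding the axiom schemas (cf): $\neg\neg\alpha\to\alpha$ and (ci): $\neg\circ\alpha\to(\alpha\wedge\neg\alpha)$. Then $\mathbf{RCi}$ is an extension of the logic $\mathbf{Ci}$ (that is, $\Gamma\vdash_{\mathbf{Ci}}\varphi$ implies $\Gamma\vdash_{\mathbf{RCi}}\varphi$) which satisfies the replacement property, derives every instance of the schema (cl): $\neg(\alpha\wedge\neg\alpha)\to\circ\alpha$, and is paraconsistent (that is, $\varphi,\neg\varphi\nvdash_{\mathbf{RCi}}\psi$ for some formulas $\varphi,\psi$).
   Context: Let $\Sigma=\{\wedge,\vee,\to,\neg,\circ\}$ ($\neg,\circ$ unary, the others binary) and let $For(\Sigma)$ be the set of formulas over $\Sigma$ generated by a denumerable set $\mathcal V$ of propositional variables. $\alpha\leftrightarrow\beta$ abbreviates $(\alpha\to\beta)\wedge(\beta\to\alpha)$. The logic $\mathbf{mbC}$ is given by the Hilbert calculus with axiom schemas: (Ax1) $\alpha\to(\beta\to\alpha)$; (Ax2) $(\alpha\to(\beta\to\gamma))\to((\alpha\to\beta)\to(\alpha\to\gamma))$; (Ax3) $\alpha\to(\beta\to(\alpha\wedge\beta))$; (Ax4) $(\alpha\wedge\beta)\to\alpha$; (Ax5) $(\alpha\wedge\beta)\to\beta$; (Ax6) $\alpha\to(\alpha\vee\beta)$; (Ax7) $\beta\to(\alpha\vee\beta)$; (Ax8) $(\alpha\to\gamma)\to((\beta\to\gamma)\to((\alpha\vee\beta)\to\gamma))$;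 (Ax9) $(\alpha\to\beta)\vee\alpha$; (Ax10) $\alpha\vee\neg\alpha$; (bc1) $\circ\alpha\to(\alpha\to(\neg\alpha\to\beta))$; and the single rule modus ponens (MP): from $\alpha$ and $\alpha\to\beta$ infer $\beta$. The logic $\mathbf{Ci}$ is $\mathbf{mbC}$ plus the axiom schemas (cf) and (ci); derivations from premises in $\mathbf{mbC}$ and $\mathbf{Ci}$ are the usual Hilbert-style ones. The calculus $\mathbf{RmbC}$ is obtained from $\mathbf{mbC}$ by adding the rules $(\mathbf R_\neg)$: from $\alpha\leftrightarrow\beta$ infer $\neg\alpha\leftrightarrow\neg\beta$; and $(\mathbf R_\circ)$: from $\alpha\leftrightarrow\beta$ infer $\circ\alpha\leftrightarrow\circ\beta$. In $\mathbf{RmbC}$ and its axiomatic extensions, $\varphi$ is a theorem ($\vdash\varphi$) if there is a finite sequence of formulas ending in $\varphi$ each of which is an instance of an axiom schema or follows from earlier formulas of the sequence by a rule; and $\Gamma\vdash\varphi$ means that either $\vdash\varphi$ or there is a finite non-empty $\{\gamma_1,\dots,\gamma_n\}\subseteq\Gamma$ with $\vdash(\gamma_1\wedge(\gamma_2\wedge(\cdots\wedge(\gamma_{n-1}\wedge\gamma_n)\cdots)))\to\varphi$. Replacement property: if $\alpha\leftrightarrow\beta$ is a theorem, then $\gamma[p/\alpha]\leftrightarrow\gamma[p/\beta]$ is a theorem for every formula $\gamma$ and variable $p$, where $\gamma[p/\alpha]$ is the result of replacing every occurrence of $p$ in $\gamma$ by $\alpha$. *)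

theory Defs
  imports Main
begin

datatype fm =
    Var nat
  | Con fm fm  (infixr "\<^bold>\<and>" 75)
  | Dis fm fm  (infixr "\<^bold>\<or>" 70)
  | Imp fm fm  (infixr "\<^bold>\<longrightarrow>" 65)
  | Neg fm     ("\<^bold>\<not> _" [80] 80)
  | Circ fm    ("\<^bold>\<circ> _" [80] 80)

definition Iff :: "fm \<Rightarrow> fm \<Rightarrow> fm"  (infix "\<^bold>\<longleftrightarrow>" 60) where
  "(\<alpha> \<^bold>\<longleftrightarrow> \<beta>) = ((\<alpha> \<^bold>\<longrightarrow> \<beta>) \<^bold>\<and> (\<beta> \<^bold>\<longrightarrow> \<alpha>))"

text \<open>\<open>subst p \<alpha> \<gamma>\<close> is \<open>\<gamma>[p/\<alpha>]\<close>: every occurrence of the variable \<open>p\<close> in \<open>\<gamma>\<close> is replaced by \<open>\<alpha>\<close>.\<close>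

primrec subst :: "nat \<Rightarrow> fm \<Rightarrow> fm \<Rightarrow> fm" where
  "subst p \<alpha> (Var q) = (if q = p then \<alpha> else Var q)"
| "subst p \<alpha> (\<gamma> \<^bold>\<and> \<delta>) = subst p \<alpha> \<gamma> \<^bold>\<and> subst p \<alpha> \<delta>"
| "subst p \<alpha> (\<gamma> \<^bold>\<or> \<delta>) = subst p \<alpha> \<gamma> \<^bold>\<or> subst p \<alpha> \<delta>"
| "subst p \<alpha> (\<gamma> \<^bold>\<longrightarrow> \<delta>) = (subst p \<alpha> \<gamma> \<^bold>\<longrightarrow> subst p \<alpha> \<delta>)"
| "subst p \<alpha> (\<^bold>\<not> \<gamma>) = \<^bold>\<not> subst p \<alpha> \<gamma>"
| "subst p \<alpha> (\<^bold>\<circ> \<gamma>) = \<^bold>\<circ> subst p \<alpha> \<gamma>"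

inductive_set mbC_axioms :: "fm set" where
  Ax1: "(\<alpha> \<^bold>\<longrightarrow> (\<beta> \<^bold>\<longrightarrow> \<alpha>)) \<in> mbC_axioms"
| Ax2: "((\<alpha> \<^bold>\<longrightarrow> (\<beta> \<^bold>\<longrightarrow> \<gamma>)) \<^bold>\<longrightarrow> ((\<alpha> \<^bold>\<longrightarrow> \<beta>) \<^bold>\<longrightarrow> (\<alpha> \<^bold>\<longrightarrow> \<gamma>))) \<in> mbC_axioms"
| Ax3: "(\<alpha> \<^bold>\<longrightarrow> (\<beta> \<^bold>\<longrightarrow> (\<alpha> \<^bold>\<and> \<beta>))) \<in> mbC_axioms"
| Ax4: "((\<alpha> \<^bold>\<and> \<beta>) \<^bold>\<longrightarrow> \<alpha>) \<in> mbC_axioms"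
| Ax5: "((\<alpha> \<^bold>\<and> \<beta>) \<^bold>\<longrightarrow> \<beta>) \<in> mbC_axioms"
| Ax6: "(\<alpha> \<^bold>\<longrightarrow> (\<alpha> \<^bold>\<or> \<beta>)) \<in> mbC_axioms"
| Ax7: "(\<beta> \<^bold>\<longrightarrow> (\<alpha> \<^bold>\<or> \<beta>)) \<in> mbC_axioms"
| Ax8: "((\<alpha> \<^bold>\<longrightarrow> \<gamma>) \<^bold>\<longrightarrow> ((\<beta> \<^bold>\<longrightarrow> \<gamma>) \<^bold>\<longrightarrow> ((\<alpha> \<^bold>\<or> \<beta>) \<^bold>\<longrightarrow> \<gamma>))) \<in> mbC_axioms"
| Ax9: "((\<alpha> \<^bold>\<longrightarrow> \<beta>) \<^bold>\<or> \<alpha>) \<in> mbC_axioms"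
| Ax10: "(\<alpha> \<^bold>\<or> (\<^bold>\<not> \<alpha>)) \<in> mbC_axioms"
| bc1: "((\<^bold>\<circ> \<alpha>) \<^bold>\<longrightarrow> (\<alpha> \<^bold>\<longrightarrow> ((\<^bold>\<not> \<alpha>) \<^bold>\<longrightarrow> \<beta>))) \<in> mbC_axioms"

definition cf_axioms :: "fm set" where
  "cf_axioms = {(\<^bold>\<not> (\<^bold>\<not> \<alpha>)) \<^bold>\<longrightarrow> \<alpha> | \<alpha>. True}"

definition ci_axioms :: "fm set" where
  "ci_axioms = {(\<^bold>\<not> (\<^bold>\<circ> \<alpha>)) \<^bold>\<longrightarrow> (\<alpha> \<^bold>\<and> (\<^bold>\<not> \<alpha>)) | \<alpha>. True}"

text \<open>A rule is the set of its instances, each a pair of a set of premises and a conclusion.\<close>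

type_synonym rule = "(fm set \<times> fm) set"

definition MP :: rule where
  "MP = {({\<alpha>, \<alpha> \<^bold>\<longrightarrow> \<beta>}, \<beta>) | \<alpha> \<beta>. True}"

definition R_neg :: rule where
  "R_neg = {({\<alpha> \<^bold>\<longleftrightarrow> \<beta>}, (\<^bold>\<not> \<alpha>) \<^bold>\<longleftrightarrow> (\<^bold>\<not> \<beta>)) | \<alpha> \<beta>. True}"

definition R_circ :: rule where
  "R_circ = {({\<alpha> \<^bold>\<longleftrightarrow> \<beta>}, (\<^bold>\<circ> \<alpha>) \<^bold>\<longleftrightarrow> (\<^bold>\<circ> \<beta>)) | \<alpha> \<beta>. True}"

definition derivation :: "fm set \<Rightarrow> rule \<Rightarrow> fm list \<Rightarrow> bool" where
  "derivation A R s \<longleftrightarrow>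
     (\<forall>i < length s. s ! i \<in> A \<or> (\<exists>P. (P, s ! i) \<in> R \<and> P \<subseteq> set (take i s)))"

definition derivable :: "fm set \<Rightarrow> rule \<Rightarrow> fm \<Rightarrow> bool" where
  "derivable A R \<phi> \<longleftrightarrow> (\<exists>s. s \<noteq> [] \<and> last s = \<phi> \<and> derivation A R s)"

text \<open>
  In \<open>hilbert_conseq\<close> the premises may be used anywhere in the derivation. In \<open>local_conseq\<close> the
  rules are applied to theorems only, and the premises enter through an implication whose
  antecedent is a conjunction nested to the right.
\<close>

definition hilbert_conseq :: "fm set \<Rightarrow> rule \<Rightarrow> fm set \<Rightarrow> fm \<Rightarrow> bool" where
  "hilbert_conseq A R \<Gamma> \<phi> \<longleftrightarrow> derivable (A \<union> \<Gamma>) R \<phi>"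

definition big_con :: "fm list \<Rightarrow> fm" where
  "big_con \<gamma>s = foldr Con (butlast \<gamma>s) (last \<gamma>s)"

definition local_conseq :: "fm set \<Rightarrow> rule \<Rightarrow> fm set \<Rightarrow> fm \<Rightarrow> bool" where
  "local_conseq A R \<Gamma> \<phi> \<longleftrightarrow>
     derivable A R \<phi> \<or>
     (\<exists>\<gamma>s. \<gamma>s \<noteq> [] \<and> set \<gamma>s \<subseteq> \<Gamma> \<and> derivable A R (big_con \<gamma>s \<^bold>\<longrightarrow> \<phi>))"

definition RmbC_rules :: rule where
  "RmbC_rules = MP \<union> R_neg \<union> R_circ"

definition Ci_axioms :: "fm set" where
  "Ci_axioms = mbC_axioms \<union> cf_axioms \<union> ci_axioms"

definition Ci_conseq :: "fm set \<Rightarrow> fm \<Rightarrow> bool"  (infix "\<turnstile>\<^sub>C\<^sub>i" 50) where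
  "\<Gamma> \<turnstile>\<^sub>C\<^sub>i \<phi> \<longleftrightarrow> hilbert_conseq Ci_axioms MP \<Gamma> \<phi>"

definition RCi_theorem :: "fm \<Rightarrow> bool" where
  "RCi_theorem \<phi> \<longleftrightarrow> derivable (mbC_axioms \<union> cf_axioms \<union> ci_axioms) RmbC_rules \<phi>"

definition RCi_conseq :: "fm set \<Rightarrow> fm \<Rightarrow> bool"  (infix "\<turnstile>\<^sub>R\<^sub>C\<^sub>i" 50) where
  "\<Gamma> \<turnstile>\<^sub>R\<^sub>C\<^sub>i \<phi> \<longleftrightarrow> local_conseq (mbC_axioms \<union> cf_axioms \<union> ci_axioms) RmbC_rules \<Gamma> \<phi>"

definition replacement_property :: "(fm \<Rightarrow> bool) \<Rightarrow> bool" where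
  "replacement_property thm_of \<longleftrightarrow>
     (\<forall>\<alpha> \<beta>. thm_of (\<alpha> \<^bold>\<longleftrightarrow> \<beta>) \<longrightarrow> (\<forall>\<gamma> p. thm_of (subst p \<alpha> \<gamma> \<^bold>\<longleftrightarrow> subst p \<beta> \<gamma>)))"

definition paraconsistent :: "(fm set \<Rightarrow> fm \<Rightarrow> bool) \<Rightarrow> bool" where
  "paraconsistent conseq \<longleftrightarrow> (\<exists>\<phi> \<psi>. \<not> conseq {\<phi>, \<^bold>\<not> \<phi>} \<psi>)"

end

(*
  In RCi the rule (R_neg) turns the provable equivalence of \<not>\<circ>\<alpha> and \<alpha> \<and> \<not>\<alpha> into one of
  \<not>\<not>\<circ>\<alpha> and \<not>(\<alpha> \<and> \<not>\<alpha>), and (cf) then yields (cl).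

  Paraconsistency is witnessed by a Boolean algebra with two extra operators. The axioms force
  \<not>a = -a \<union> g a and \<circ>a = -(g a), where g a \<subseteq> a, g (-(g a)) = {} and g (\<not>a) \<subseteq> g a. A
  nontrivial such g needs four atoms: on the square of the two-element set let X and Y be the two
  coordinate sets, g X = X \<inter> Y, g (-X) = -X \<inter> Y, and g a = {} otherwise.
*)

theory Submission
  imports Defs
begin

section \<open>Derivations\<close>

text \<open>Placing \<open>s\<close> in front only enlarges the stock of earlier formulas available
  to each step of \<open>t\<close>, and steps of \<open>s\<close> see exactly what they saw
  before.\<close>

lemma derivation_append:
  assumes "derivation A R s" and "derivation A R t"
  shows "derivation A R (s @ t)"
  unfolding derivation_def
proof (intro allI impI)
  fix i assume i: "i < length (s @ t)"
  show "(s @ t) ! i \<in> A \<or> (\<exists>P. (P, (s @ t) ! i) \<in> R \<and> P \<subseteq> set (take i (s @ t)))"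
  proof (cases "i < length s")
    case True
    then show ?thesis
      using assms(1) by (simp add: derivation_def nth_append)
  next
    case False
    with i have "i - length s < length t" by simp
    with assms(2) have "t ! (i - length s) \<in> A \<or>
        (\<exists>P. (P, t ! (i - length s)) \<in> R \<and> P \<subseteq> set (take (i - length s) t))"
      by (simp add: derivation_def)
    with False show ?thesis
      by (auto simp: nth_append)
  qed
qed

lemma derivation_snoc:
  assumes "derivation A R s" and "\<phi> \<in> A \<or> (\<exists>P. (P, \<phi>) \<in> R \<and> P \<subseteq> set s)"
  shows "derivation A R (s @ [\<phi>])"
  using assms by (auto simp: derivation_def nth_append less_Suc_eq)

lemma derivable_axiom:
  assumes "\<phi> \<in> A"
  shows "derivable A R \<phi>"
  unfolding derivable_def
  by (rule exI[of _ "[\<phi>]"]) (simp add: assms derivation_def)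

text \<open>A rule needs all its premises inside one sequence, whereas each premise comes with a
  derivation of its own; concatenating these derivations supplies the common one.\<close>

lemma finite_derivables_derivation:
  assumes "finite P" and "\<And>\<psi>. \<psi> \<in> P \<Longrightarrow> derivable A R \<psi>"
  shows "\<exists>s. derivation A R s \<and> P \<subseteq> set s"
  using assms
proof (induction P rule: finite_induct)
  case empty
  have "derivation A R []" by (simp add: derivation_def)
  then show ?case by blast
next
  case (insert \<psi> P)
  then obtain s where s: "derivation A R s" "P \<subseteq> set s" by blast
  obtain t where t: "t \<noteq> []" "last t = \<psi>" "derivation A R t"
    using insert.prems[of \<psi>] by (auto simp: derivable_def)
  have "insert \<psi> P \<subseteq> set (s @ t)"
    using s(2) t(1,2) last_in_set by auto
  then show ?case
    using derivation_append[OF s(1) t(3)] by blast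
qed

lemma derivable_rule:
  assumes "(P, \<phi>) \<in> R" and "finite P" and "\<And>\<psi>. \<psi> \<in> P \<Longrightarrow> derivable A R \<psi>"
  shows "derivable A R \<phi>"
proof -
  obtain s where "derivation A R s" "P \<subseteq> set s"
    using finite_derivables_derivation assms(2,3) by blast
  then have "derivation A R (s @ [\<phi>])"
    using derivation_snoc assms(1) by blast
  then show ?thesis
    unfolding derivable_def by (intro exI[of _ "s @ [\<phi>]"]) simp
qed

text \<open>Strong induction on positions, as the premises of a step stand strictly earlier. Later
  arguments use this rule induction instead of explicit sequences.\<close>

lemma derivable_induct [consumes 1, case_names ax rule]:
  assumes "derivable A R \<phi>"
    and ax: "\<And>\<psi>. \<psi> \<in> A \<Longrightarrow> Q \<psi>"
    and rule: "\<And>P \<psi>. (P, \<psi>) \<in> R \<Longrightarrow> (\<And>\<chi>. \<chi> \<in> P \<Longrightarrow> Q \<chi>) \<Longrightarrow> Q \<psi>"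
  shows "Q \<phi>"
proof -
  obtain s where s: "s \<noteq> []" "last s = \<phi>" "derivation A R s"
    using assms(1) by (auto simp: derivable_def)
  have "i < length s \<Longrightarrow> Q (s ! i)" for i
  proof (induction i rule: less_induct)
    case (less i)
    have prev: "Q \<chi>" if "\<chi> \<in> set (take i s)" for \<chi>
      using that less by (auto simp: in_set_conv_nth)
    have "s ! i \<in> A \<or> (\<exists>P. (P, s ! i) \<in> R \<and> P \<subseteq> set (take i s))"
      using s(3) less.prems by (simp add: derivation_def)
    then show ?case
      using ax rule prev by blast
  qed
  then show ?thesis
    using s(1,2) by (metis last_in_set in_set_conv_nth)
qed

section \<open>Positive propositional reasoning in RCi\<close>

lemma RCi_axiom: "\<phi> \<in> mbC_axioms \<Longrightarrow> RCi_theorem \<phi>"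
  by (simp add: RCi_theorem_def derivable_axiom)

lemma RCi_cf: "RCi_theorem (\<^bold>\<not> (\<^bold>\<not> \<alpha>) \<^bold>\<longrightarrow> \<alpha>)"
  unfolding RCi_theorem_def by (rule derivable_axiom) (auto simp: cf_axioms_def)

lemma RCi_ci: "RCi_theorem (\<^bold>\<not> (\<^bold>\<circ> \<alpha>) \<^bold>\<longrightarrow> \<alpha> \<^bold>\<and> \<^bold>\<not> \<alpha>)"
  unfolding RCi_theorem_def by (rule derivable_axiom) (auto simp: ci_axioms_def)

lemma RCi_MP:
  assumes "RCi_theorem (\<alpha> \<^bold>\<longrightarrow> \<beta>)" and "RCi_theorem \<alpha>"
  shows "RCi_theorem \<beta>"
  unfolding RCi_theorem_def
  by (rule derivable_rule[of "{\<alpha>, \<alpha> \<^bold>\<longrightarrow> \<beta>}"])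
    (use assms in \<open>auto simp: RmbC_rules_def MP_def RCi_theorem_def\<close>)

lemma RCi_R_neg:
  assumes "RCi_theorem (\<alpha> \<^bold>\<longleftrightarrow> \<beta>)"
  shows "RCi_theorem ((\<^bold>\<not> \<alpha>) \<^bold>\<longleftrightarrow> (\<^bold>\<not> \<beta>))"
  unfolding RCi_theorem_def
  by (rule derivable_rule[of "{\<alpha> \<^bold>\<longleftrightarrow> \<beta>}"])
    (use assms in \<open>auto simp: RmbC_rules_def R_neg_def RCi_theorem_def\<close>)

lemma RCi_R_circ:
  assumes "RCi_theorem (\<alpha> \<^bold>\<longleftrightarrow> \<beta>)"
  shows "RCi_theorem ((\<^bold>\<circ> \<alpha>) \<^bold>\<longleftrightarrow> (\<^bold>\<circ> \<beta>))"
  unfolding RCi_theorem_def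
  by (rule derivable_rule[of "{\<alpha> \<^bold>\<longleftrightarrow> \<beta>}"])
    (use assms in \<open>auto simp: RmbC_rules_def R_circ_def RCi_theorem_def\<close>)

lemma RCi_weaken: "RCi_theorem \<phi> \<Longrightarrow> RCi_theorem (\<delta> \<^bold>\<longrightarrow> \<phi>)"
  using RCi_MP[OF RCi_axiom[OF Ax1]] .

text \<open>Ax2 is modus ponens below a common antecedent. With \<open>RCi_weaken\<close> it takes
  the place of a deduction theorem.\<close>

lemma RCi_MP_under:
  assumes "RCi_theorem (\<delta> \<^bold>\<longrightarrow> (\<alpha> \<^bold>\<longrightarrow> \<beta>))" and "RCi_theorem (\<delta> \<^bold>\<longrightarrow> \<alpha>)"
  shows "RCi_theorem (\<delta> \<^bold>\<longrightarrow> \<beta>)"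
  using RCi_MP[OF RCi_MP[OF RCi_axiom[OF Ax2] assms(1)] assms(2)] .

lemma RCi_trans:
  assumes "RCi_theorem (\<alpha> \<^bold>\<longrightarrow> \<beta>)" and "RCi_theorem (\<beta> \<^bold>\<longrightarrow> \<gamma>)"
  shows "RCi_theorem (\<alpha> \<^bold>\<longrightarrow> \<gamma>)"
  using RCi_MP_under[OF RCi_weaken[OF assms(2)] assms(1)] .

lemma RCi_refl: "RCi_theorem (\<alpha> \<^bold>\<longrightarrow> \<alpha>)"
  using RCi_MP_under[OF RCi_axiom[OF Ax1[of _ "\<alpha> \<^bold>\<longrightarrow> \<alpha>"]] RCi_axiom[OF Ax1]] .

lemma RCi_con_under:
  assumes "RCi_theorem (\<delta> \<^bold>\<longrightarrow> \<alpha>)" and "RCi_theorem (\<delta> \<^bold>\<longrightarrow> \<beta>)"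
  shows "RCi_theorem (\<delta> \<^bold>\<longrightarrow> \<alpha> \<^bold>\<and> \<beta>)"
  using RCi_MP_under[OF RCi_trans[OF assms(1) RCi_axiom[OF Ax3]] assms(2)] .

lemma RCi_dis_elim:
  assumes "RCi_theorem (\<alpha> \<^bold>\<longrightarrow> \<gamma>)" and "RCi_theorem (\<beta> \<^bold>\<longrightarrow> \<gamma>)"
  shows "RCi_theorem (\<alpha> \<^bold>\<or> \<beta> \<^bold>\<longrightarrow> \<gamma>)"
  using RCi_MP[OF RCi_MP[OF RCi_axiom[OF Ax8] assms(1)] assms(2)] .

lemma RCi_swap:
  assumes "RCi_theorem (\<alpha> \<^bold>\<longrightarrow> (\<beta> \<^bold>\<longrightarrow> \<gamma>))"
  shows "RCi_theorem (\<beta> \<^bold>\<longrightarrow> (\<alpha> \<^bold>\<longrightarrow> \<gamma>))"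
  using RCi_trans[OF RCi_axiom[OF Ax1] RCi_MP[OF RCi_axiom[OF Ax2] assms]] .

lemma RCi_imp_con:
  "RCi_theorem ((\<alpha> \<^bold>\<longrightarrow> (\<beta> \<^bold>\<longrightarrow> \<gamma>)) \<^bold>\<longrightarrow> (\<alpha> \<^bold>\<and> \<beta> \<^bold>\<longrightarrow> \<gamma>))"
\<comment> \<open>With \<alpha> \<and> \<beta> as the outer antecedent, Ax4 and Ax5 deliver both
  arguments to which \<open>?H\<close> is applied.\<close>
proof (rule RCi_swap)
  let ?H = "\<alpha> \<^bold>\<longrightarrow> (\<beta> \<^bold>\<longrightarrow> \<gamma>)"
  \<comment> \<open>Swapping the identity on \<open>?H\<close> internalises application: it gives
    \<alpha> \<longrightarrow> (\<open>?H\<close> \<longrightarrow> (\<beta> \<longrightarrow>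
    \<gamma>)).\<close>
  have "RCi_theorem (\<alpha> \<^bold>\<and> \<beta> \<^bold>\<longrightarrow> (?H \<^bold>\<longrightarrow> (\<beta> \<^bold>\<longrightarrow> \<gamma>)))"
    using RCi_trans[OF RCi_axiom[OF Ax4] RCi_swap[OF RCi_refl]] .
  then have "RCi_theorem (\<alpha> \<^bold>\<and> \<beta> \<^bold>\<longrightarrow> ((?H \<^bold>\<longrightarrow> \<beta>) \<^bold>\<longrightarrow> (?H \<^bold>\<longrightarrow> \<gamma>)))"
    using RCi_axiom[OF Ax2] by (rule RCi_trans)
  moreover have "RCi_theorem (\<alpha> \<^bold>\<and> \<beta> \<^bold>\<longrightarrow> (?H \<^bold>\<longrightarrow> \<beta>))"
    using RCi_trans[OF RCi_axiom[OF Ax5] RCi_axiom[OF Ax1]] .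
  ultimately show "RCi_theorem (\<alpha> \<^bold>\<and> \<beta> \<^bold>\<longrightarrow> (?H \<^bold>\<longrightarrow> \<gamma>))"
    by (rule RCi_MP_under)
qed

lemma RCi_Iff_iff:
  "RCi_theorem (\<alpha> \<^bold>\<longleftrightarrow> \<beta>) \<longleftrightarrow> RCi_theorem (\<alpha> \<^bold>\<longrightarrow> \<beta>) \<and> RCi_theorem (\<beta> \<^bold>\<longrightarrow> \<alpha>)"
  (is "?L \<longleftrightarrow> ?R")
proof
  assume ?L
  then show ?R
    unfolding Iff_def
    by (intro conjI) (erule RCi_MP[OF RCi_axiom[OF Ax4]], erule RCi_MP[OF RCi_axiom[OF Ax5]])
next
  assume ?R
  then show ?L
    unfolding Iff_def by (elim conjE) (rule RCi_MP[OF RCi_MP[OF RCi_axiom[OF Ax3]]])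
qed

section \<open>Replacement and (cl)\<close>

lemma RCi_con_mono:
  assumes "RCi_theorem (\<alpha> \<^bold>\<longrightarrow> \<alpha>')" and "RCi_theorem (\<beta> \<^bold>\<longrightarrow> \<beta>')"
  shows "RCi_theorem (\<alpha> \<^bold>\<and> \<beta> \<^bold>\<longrightarrow> \<alpha>' \<^bold>\<and> \<beta>')"
  using RCi_con_under[OF RCi_trans[OF RCi_axiom[OF Ax4] assms(1)]
      RCi_trans[OF RCi_axiom[OF Ax5] assms(2)]] .

lemma RCi_dis_mono:
  assumes "RCi_theorem (\<alpha> \<^bold>\<longrightarrow> \<alpha>')" and "RCi_theorem (\<beta> \<^bold>\<longrightarrow> \<beta>')"
  shows "RCi_theorem (\<alpha> \<^bold>\<or> \<beta> \<^bold>\<longrightarrow> \<alpha>' \<^bold>\<or> \<beta>')"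
  using RCi_dis_elim[OF RCi_trans[OF assms(1) RCi_axiom[OF Ax6]]
      RCi_trans[OF assms(2) RCi_axiom[OF Ax7]]] .

lemma RCi_imp_mono:
  assumes "RCi_theorem (\<alpha>' \<^bold>\<longrightarrow> \<alpha>)" and "RCi_theorem (\<beta> \<^bold>\<longrightarrow> \<beta>')"
  shows "RCi_theorem ((\<alpha> \<^bold>\<longrightarrow> \<beta>) \<^bold>\<longrightarrow> (\<alpha>' \<^bold>\<longrightarrow> \<beta>'))"
proof -
  have "RCi_theorem ((\<alpha> \<^bold>\<longrightarrow> \<beta>) \<^bold>\<longrightarrow> (\<alpha>' \<^bold>\<longrightarrow> \<beta>))"
    using RCi_swap[OF RCi_trans[OF assms(1) RCi_swap[OF RCi_refl]]] .
  moreover have "RCi_theorem ((\<alpha>' \<^bold>\<longrightarrow> \<beta>) \<^bold>\<longrightarrow> (\<alpha>' \<^bold>\<longrightarrow> \<beta>'))"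
    using RCi_MP[OF RCi_axiom[OF Ax2] RCi_weaken[OF assms(2)]] .
  ultimately show ?thesis
    by (rule RCi_trans)
qed

text \<open>Induction on \<gamma>: the two extra rules are exactly the cases of \<not> and \<circ>,
  and the positive connectives are monotone, the implication being antitone in its
  antecedent.\<close>

lemma RCi_replacement:
  assumes "RCi_theorem (\<alpha> \<^bold>\<longleftrightarrow> \<beta>)"
  shows "RCi_theorem (subst p \<alpha> \<gamma> \<^bold>\<longleftrightarrow> subst p \<beta> \<gamma>)"
proof (induction \<gamma>)
  case (Var q)
  then show ?case using assms by (simp add: RCi_Iff_iff RCi_refl)
next
  case (Neg \<gamma>)
  then show ?case by (simp add: RCi_R_neg)
next
  case (Circ \<gamma>)
  then show ?case by (simp add: RCi_R_circ)
qed (simp_all add: RCi_Iff_iff RCi_con_mono RCi_dis_mono RCi_imp_mono)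

text \<open>One direction is (ci). For the converse, split on \<circ>\<alpha> by Ax10: if
  \<circ>\<alpha> holds, (bc1) lets \<alpha> and \<not>\<alpha> yield anything, in particular
  \<not>\<circ>\<alpha>; otherwise \<not>\<circ>\<alpha> is already given.\<close>

lemma RCi_neg_circ_iff: "RCi_theorem ((\<^bold>\<not> (\<^bold>\<circ> \<alpha>)) \<^bold>\<longleftrightarrow> (\<alpha> \<^bold>\<and> \<^bold>\<not> \<alpha>))"
proof -
  have "RCi_theorem ((\<alpha> \<^bold>\<longrightarrow> (\<^bold>\<not> \<alpha> \<^bold>\<longrightarrow> \<^bold>\<not> (\<^bold>\<circ> \<alpha>))) \<^bold>\<longrightarrow> (\<alpha> \<^bold>\<and> \<^bold>\<not> \<alpha> \<^bold>\<longrightarrow> \<^bold>\<not> (\<^bold>\<circ> \<alpha>)))"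
    by (rule RCi_imp_con)
  then have "RCi_theorem (\<^bold>\<circ> \<alpha> \<^bold>\<longrightarrow> (\<alpha> \<^bold>\<and> \<^bold>\<not> \<alpha> \<^bold>\<longrightarrow> \<^bold>\<not> (\<^bold>\<circ> \<alpha>)))"
    by (rule RCi_trans[OF RCi_axiom[OF bc1]])
  then have "RCi_theorem (\<^bold>\<circ> \<alpha> \<^bold>\<or> \<^bold>\<not> (\<^bold>\<circ> \<alpha>) \<^bold>\<longrightarrow> (\<alpha> \<^bold>\<and> \<^bold>\<not> \<alpha> \<^bold>\<longrightarrow> \<^bold>\<not> (\<^bold>\<circ> \<alpha>)))"
    by (rule RCi_dis_elim) (rule RCi_axiom[OF Ax1])
  then have "RCi_theorem (\<alpha> \<^bold>\<and> \<^bold>\<not> \<alpha> \<^bold>\<longrightarrow> \<^bold>\<not> (\<^bold>\<circ> \<alpha>))"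
    using RCi_axiom[OF Ax10] by (rule RCi_MP)
  then show ?thesis
    by (simp add: RCi_Iff_iff RCi_ci)
qed

lemma RCi_cl: "RCi_theorem (\<^bold>\<not> (\<alpha> \<^bold>\<and> \<^bold>\<not> \<alpha>) \<^bold>\<longrightarrow> \<^bold>\<circ> \<alpha>)"
proof (rule RCi_trans[OF _ RCi_cf])
  show "RCi_theorem (\<^bold>\<not> (\<alpha> \<^bold>\<and> \<^bold>\<not> \<alpha>) \<^bold>\<longrightarrow> \<^bold>\<not> (\<^bold>\<not> (\<^bold>\<circ> \<alpha>)))"
    using RCi_R_neg[OF RCi_neg_circ_iff] by (simp add: RCi_Iff_iff)
qed

section \<open>RCi extends Ci\<close>

lemma big_con_Cons: "big_con (\<gamma> # \<gamma>s) = (if \<gamma>s = [] then \<gamma> else \<gamma> \<^bold>\<and> big_con \<gamma>s)"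
  by (simp add: big_con_def)

lemma RCi_big_con_elim: "\<gamma> \<in> set \<gamma>s \<Longrightarrow> RCi_theorem (big_con \<gamma>s \<^bold>\<longrightarrow> \<gamma>)"
proof (induction \<gamma>s)
  case (Cons \<delta> \<gamma>s)
  then show ?case
    using RCi_refl RCi_axiom[OF Ax4] RCi_trans[OF RCi_axiom[OF Ax5]]
    by (auto simp: big_con_Cons)
qed simp

lemma RCi_big_con_intro:
  "\<gamma>s \<noteq> [] \<Longrightarrow> (\<And>\<gamma>. \<gamma> \<in> set \<gamma>s \<Longrightarrow> RCi_theorem (\<delta> \<^bold>\<longrightarrow> \<gamma>)) \<Longrightarrow> RCi_theorem (\<delta> \<^bold>\<longrightarrow> big_con \<gamma>s)"
  by (induction \<gamma>s) (auto simp: big_con_Cons RCi_con_under)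

text \<open>Serves to merge premises: the conjunction of a concatenation implies the conjunction of
  either nonempty part.\<close>

lemma RCi_big_con_antimono:
  assumes "\<gamma>s \<noteq> []" and "set \<gamma>s \<subseteq> set \<delta>s"
  shows "RCi_theorem (big_con \<delta>s \<^bold>\<longrightarrow> big_con \<gamma>s)"
  using assms by (intro RCi_big_con_intro RCi_big_con_elim) auto

section \<open>Closure properties of the consequence relation\<close>

lemma RCi_conseq_iff:
  "\<Gamma> \<turnstile>\<^sub>R\<^sub>C\<^sub>i \<phi> \<longleftrightarrow> RCi_theorem \<phi> \<or>
    (\<exists>\<gamma>s. \<gamma>s \<noteq> [] \<and> set \<gamma>s \<subseteq> \<Gamma> \<and> RCi_theorem (big_con \<gamma>s \<^bold>\<longrightarrow> \<phi>))"
  by (simp add: RCi_conseq_def local_conseq_def RCi_theorem_def)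

lemma RCi_conseq_premise: "\<gamma> \<in> \<Gamma> \<Longrightarrow> \<Gamma> \<turnstile>\<^sub>R\<^sub>C\<^sub>i \<gamma>"
  using RCi_big_con_elim[of \<gamma> "[\<gamma>]"] by (force simp: RCi_conseq_iff)

lemma RCi_conseq_MP:
  assumes "\<Gamma> \<turnstile>\<^sub>R\<^sub>C\<^sub>i \<alpha> \<^bold>\<longrightarrow> \<beta>" and "\<Gamma> \<turnstile>\<^sub>R\<^sub>C\<^sub>i \<alpha>"
  shows "\<Gamma> \<turnstile>\<^sub>R\<^sub>C\<^sub>i \<beta>"
proof (cases "\<Gamma> = {}")
  case True
  then show ?thesis using assms RCi_MP[of \<alpha> \<beta>] by (simp add: RCi_conseq_iff)
next
  case False
  then obtain \<gamma> where \<gamma>: "\<gamma> \<in> \<Gamma>" by blast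
  \<comment> \<open>A theorem can be weakened by the arbitrary premise \<gamma>, so both hypotheses
    take the form with a nonempty list and need no separate treatment.\<close>
  have list: "\<exists>\<gamma>s. \<gamma>s \<noteq> [] \<and> set \<gamma>s \<subseteq> \<Gamma> \<and> RCi_theorem (big_con \<gamma>s \<^bold>\<longrightarrow> \<phi>)"
    if "\<Gamma> \<turnstile>\<^sub>R\<^sub>C\<^sub>i \<phi>" for \<phi>
    using that unfolding RCi_conseq_iff
  proof
    assume "RCi_theorem \<phi>"
    then show ?thesis
      using \<gamma> RCi_weaken by (intro exI[of _ "[\<gamma>]"]) simp
  qed
  obtain xs where xs: "xs \<noteq> []" "set xs \<subseteq> \<Gamma>" "RCi_theorem (big_con xs \<^bold>\<longrightarrow> (\<alpha> \<^bold>\<longrightarrow> \<beta>))"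
    using list[OF assms(1)] by blast
  obtain ys where ys: "ys \<noteq> []" "set ys \<subseteq> \<Gamma>" "RCi_theorem (big_con ys \<^bold>\<longrightarrow> \<alpha>)"
    using list[OF assms(2)] by blast
  have "RCi_theorem (big_con (xs @ ys) \<^bold>\<longrightarrow> (\<alpha> \<^bold>\<longrightarrow> \<beta>))"
    using RCi_trans[OF RCi_big_con_antimono xs(3)] xs(1) by simp
  moreover have "RCi_theorem (big_con (xs @ ys) \<^bold>\<longrightarrow> \<alpha>)"
    using RCi_trans[OF RCi_big_con_antimono ys(3)] ys(1) by simp
  ultimately have "RCi_theorem (big_con (xs @ ys) \<^bold>\<longrightarrow> \<beta>)"
    by (rule RCi_MP_under)
  then show ?thesis
    unfolding RCi_conseq_iff using xs ys by (intro disjI2 exI[of _ "xs @ ys"]) simp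
qed

text \<open>Modus ponens is the only rule of Ci, so it suffices that the local consequence relation
  contains the axioms and premises and is closed under it; the rules restricted to theorems never
  meet a premise.\<close>

lemma Ci_conseq_imp_RCi_conseq:
  assumes "\<Gamma> \<turnstile>\<^sub>C\<^sub>i \<phi>"
  shows "\<Gamma> \<turnstile>\<^sub>R\<^sub>C\<^sub>i \<phi>"
  using assms unfolding Ci_conseq_def hilbert_conseq_def
proof (induction rule: derivable_induct)
  case (ax \<psi>)
  then show ?case
  proof
    assume "\<psi> \<in> Ci_axioms"
    then have "RCi_theorem \<psi>"
      by (simp add: RCi_theorem_def Ci_axioms_def derivable_axiom)
    then show ?thesis by (simp add: RCi_conseq_iff)
  qed (rule RCi_conseq_premise)
next
  case (rule P \<psi>)
  then obtain \<alpha> where "P = {\<alpha>, \<alpha> \<^bold>\<longrightarrow> \<psi>}" by (auto simp: MP_def)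
  with rule.IH have "\<Gamma> \<turnstile>\<^sub>R\<^sub>C\<^sub>i \<alpha> \<^bold>\<longrightarrow> \<psi>" "\<Gamma> \<turnstile>\<^sub>R\<^sub>C\<^sub>i \<alpha>" by simp_all
  then show ?case by (rule RCi_conseq_MP)
qed

section \<open>Paraconsistency\<close>

definition coord1 :: "(bool \<times> bool) set" where
  "coord1 = {w. fst w}"

definition coord2 :: "(bool \<times> bool) set" where
  "coord2 = {w. snd w}"

text \<open>The points at which a proposition holds together with its negation.\<close>

definition glut :: "(bool \<times> bool) set \<Rightarrow> (bool \<times> bool) set" where
  "glut a = (if a = coord1 \<or> a = - coord1 then a \<inter> coord2 else {})"

lemma glut_subset: "glut a \<subseteq> a"
  by (simp add: glut_def)

text \<open>A glut has at most one point, so its complement has at least three, while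
  \<open>coord1\<close> and its complement have two. Hence \<not>\<circ>\<alpha> denotes the glut of
  \<alpha>, as (ci) demands.\<close>

lemma glut_compl_glut: "glut (- glut a) = {}"
proof -
  have "- glut a \<noteq> coord1" "- glut a \<noteq> - coord1"
    by (auto simp: glut_def coord1_def coord2_def set_eq_iff)
  then show ?thesis by (simp add: glut_def)
qed

text \<open>If \<open>a\<close> is \<open>coord1\<close> or its complement, its negation has three
  points and thus an empty glut; otherwise negation is the plain complement, which is again neither
  of the two sets. With \<open>glut_subset\<close> this validates (cf).\<close>

lemma glut_neg_subset: "glut (- a \<union> glut a) \<subseteq> glut a"
proof (cases "a = coord1 \<or> a = - coord1")
  case True
  then have "- a \<union> glut a \<noteq> coord1" "- a \<union> glut a \<noteq> - coord1"
    by (auto simp: glut_def coord1_def coord2_def set_eq_iff)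
  then show ?thesis by (simp add: glut_def)
next
  case False
  then have "- a \<noteq> coord1" "- a \<noteq> - coord1" by auto
  with False show ?thesis by (simp add: glut_def)
qed

text \<open>One valuation is enough for a countermodel: every variable denotes
  \<open>coord1\<close>, whose glut is nonempty.\<close>

primrec sem :: "fm \<Rightarrow> (bool \<times> bool) set" where
  "sem (Var q) = coord1"
| "sem (\<gamma> \<^bold>\<and> \<delta>) = sem \<gamma> \<inter> sem \<delta>"
| "sem (\<gamma> \<^bold>\<or> \<delta>) = sem \<gamma> \<union> sem \<delta>"
| "sem (\<gamma> \<^bold>\<longrightarrow> \<delta>) = - sem \<gamma> \<union> sem \<delta>"
| "sem (\<^bold>\<not> \<gamma>) = - sem \<gamma> \<union> glut (sem \<gamma>)"
| "sem (\<^bold>\<circ> \<gamma>) = - glut (sem \<gamma>)"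

section \<open>Soundness and the countermodel\<close>

lemma sem_Iff: "sem (\<alpha> \<^bold>\<longleftrightarrow> \<beta>) = UNIV \<longleftrightarrow> sem \<alpha> = sem \<beta>"
  by (auto simp: Iff_def)

text \<open>The positive axioms are Boolean. Ax10 holds as negation contains the complement, and
  (bc1) because \<open>a\<close> meets its negation only in \<open>glut a\<close>, which \<circ>
  excludes.\<close>

lemma sem_mbC_axioms: "\<phi> \<in> mbC_axioms \<Longrightarrow> sem \<phi> = UNIV"
  by (induction rule: mbC_axioms.induct) auto

lemma sem_cf_axioms: "\<phi> \<in> cf_axioms \<Longrightarrow> sem \<phi> = UNIV"
  using glut_neg_subset glut_subset by (fastforce simp: cf_axioms_def)

lemma sem_ci_axioms: "\<phi> \<in> ci_axioms \<Longrightarrow> sem \<phi> = UNIV"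
  using glut_subset by (fastforce simp: ci_axioms_def glut_compl_glut)

text \<open>The replacement rules preserve validity since, by \<open>sem_Iff\<close>, a valid
  biconditional means equal values, and \<not> and \<circ> are operations on values.\<close>

lemma RCi_sound: "RCi_theorem \<phi> \<Longrightarrow> sem \<phi> = UNIV"
  unfolding RCi_theorem_def
proof (induction rule: derivable_induct)
  case (ax \<psi>)
  then show ?case using sem_mbC_axioms sem_cf_axioms sem_ci_axioms by blast
next
  case (rule P \<psi>)
  from rule.hyps consider \<alpha> where "P = {\<alpha>, \<alpha> \<^bold>\<longrightarrow> \<psi>}"
    | \<alpha> \<beta> where "P = {\<alpha> \<^bold>\<longleftrightarrow> \<beta>}" "\<psi> = ((\<^bold>\<not> \<alpha>) \<^bold>\<longleftrightarrow> (\<^bold>\<not> \<beta>))"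
    | \<alpha> \<beta> where "P = {\<alpha> \<^bold>\<longleftrightarrow> \<beta>}" "\<psi> = ((\<^bold>\<circ> \<alpha>) \<^bold>\<longleftrightarrow> (\<^bold>\<circ> \<beta>))"
    unfolding RmbC_rules_def MP_def R_neg_def R_circ_def by blast
  then show ?case
  proof cases
    case (1 \<alpha>)
    then have "sem \<alpha> = UNIV" "sem (\<alpha> \<^bold>\<longrightarrow> \<psi>) = UNIV"
      by (simp_all add: rule.IH del: sem.simps)
    then show ?thesis by simp
  next
    case (2 \<alpha> \<beta>)
    then have "sem (\<alpha> \<^bold>\<longleftrightarrow> \<beta>) = UNIV" by (simp add: rule.IH)
    then show ?thesis by (simp add: 2 sem_Iff)
  next
    case (3 \<alpha> \<beta>)
    then have "sem (\<alpha> \<^bold>\<longleftrightarrow> \<beta>) = UNIV" by (simp add: rule.IH)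
    then show ?thesis by (simp add: 3 sem_Iff)
  qed
qed

lemma sem_big_con: "\<gamma>s \<noteq> [] \<Longrightarrow> sem (big_con \<gamma>s) = (\<Inter>\<gamma>\<in>set \<gamma>s. sem \<gamma>)"
  by (induction \<gamma>s) (auto simp: big_con_Cons)

text \<open>Premises enter through a valid implication, and a valid implication is an inclusion of
  values; so truth is preserved at each point, not just validity.\<close>

lemma RCi_conseq_sound:
  assumes "\<Gamma> \<turnstile>\<^sub>R\<^sub>C\<^sub>i \<phi>"
  shows "(\<Inter>\<gamma>\<in>\<Gamma>. sem \<gamma>) \<subseteq> sem \<phi>"
  using assms unfolding RCi_conseq_iff
proof (elim disjE exE conjE)
  fix \<gamma>s assume \<gamma>s: "\<gamma>s \<noteq> []" "set \<gamma>s \<subseteq> \<Gamma>" "RCi_theorem (big_con \<gamma>s \<^bold>\<longrightarrow> \<phi>)"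
  have "sem (big_con \<gamma>s) \<subseteq> sem \<phi>"
    using RCi_sound[OF \<gamma>s(3)] by auto
  then show ?thesis
    using \<gamma>s(1,2) by (auto simp: sem_big_con)
qed (simp add: RCi_sound)

text \<open>The value of \<circ>p omits only the point \<open>(True, True)\<close>, and there p and
  \<not>p both hold.\<close>

lemma RCi_paraconsistent: "\<not> {Var p, \<^bold>\<not> Var p} \<turnstile>\<^sub>R\<^sub>C\<^sub>i \<^bold>\<circ> Var p"
proof
  assume "{Var p, \<^bold>\<not> Var p} \<turnstile>\<^sub>R\<^sub>C\<^sub>i \<^bold>\<circ> Var p"
  then have "coord1 \<inter> (- coord1 \<union> glut coord1) \<subseteq> - glut coord1"
    using RCi_conseq_sound by fastforce
  moreover have "(True, True) \<in> coord1 \<inter> glut coord1"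
    by (simp add: glut_def coord1_def coord2_def)
  ultimately show False by blast
qed

theorem mainTheorem2:
  shows "(\<forall>\<Gamma> \<phi>. \<Gamma> \<turnstile>\<^sub>C\<^sub>i \<phi> \<longrightarrow> \<Gamma> \<turnstile>\<^sub>R\<^sub>C\<^sub>i \<phi>)
    \<and> replacement_property RCi_theorem
    \<and> (\<forall>\<alpha>. RCi_theorem ((\<^bold>\<not> (\<alpha> \<^bold>\<and> (\<^bold>\<not> \<alpha>))) \<^bold>\<longrightarrow> (\<^bold>\<circ> \<alpha>)))
    \<and> paraconsistent (\<lambda>\<Gamma> \<phi>. \<Gamma> \<turnstile>\<^sub>R\<^sub>C\<^sub>i \<phi>)"
proof (intro conjI)
  show "\<forall>\<Gamma> \<phi>. \<Gamma> \<turnstile>\<^sub>C\<^sub>i \<phi> \<longrightarrow> \<Gamma> \<turnstile>\<^sub>R\<^sub>C\<^sub>i \<phi>"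
    by (simp add: Ci_conseq_imp_RCi_conseq)
  show "replacement_property RCi_theorem"
    by (simp add: replacement_property_def RCi_replacement)
  show "\<forall>\<alpha>. RCi_theorem (\<^bold>\<not> (\<alpha> \<^bold>\<and> \<^bold>\<not> \<alpha>) \<^bold>\<longrightarrow> \<^bold>\<circ> \<alpha>)"
    by (simp add: RCi_cl)
  show "paraconsistent (\<lambda>\<Gamma> \<phi>. \<Gamma> \<turnstile>\<^sub>R\<^sub>C\<^sub>i \<phi>)"
    unfolding paraconsistent_def by (rule exI, rule exI, rule RCi_paraconsistent)
qed

end
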